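(* Let $G=(V,E)$ be a vertex-capacitated graph with $n=|V|$, let $A$ be a node-weighting of $G$, and let $h>1$, $\phi<1$ and a length slack parameter $s=O(\log n)$ be given. Then there is an $(h,s)$-length $\phi$-expander decomposition for $A$ with cut slack $\kappa=O(n^{O(1/s)}\log n)$; that is, there is an $h\cdot s$-length moving cut $C$ of $G$ with $|C|\le\kappa\cdot\phi\cdot|A|$ such that $A$ is $(h,s)$-length $\phi$-expanding in $G-C$ (the $O(\cdot)$'s hide absolute constants).
   Context: A vertex-capacitated graph is a finite undirected graph $G=(V,E)$ with a length function $\ell:V\cup E\to\mathbb{Z}_{>0}$ and a capacity function $u:V\cup E\to\mathbb{Z}_{>0}$, all values bounded by $N=\mathrm{poly}(n)$. The length of a simple path is the sum of the lengths of its vertices and edges; $\mathrm{dist}_G(v,w)$ is the minimum length of a $v$–$w$ path. A node-weighting is $A:V\to\mathbb{R}_{\ge 0}$, $|A|=\sum_vA(v)$. A demand is $D:V\times V\to\mathbb{R}_{\ge0}$; it is $A$-respecting if $\max\{\sum_wD(v,w),\sum_wD(w,v)\}\le A(v)$ for all $v$, and $h$-length if $D(v,w)>0$ implies $\mathrm{dist}_G(v,w)\le h$. For $H>0$, an $H$-length moving cut is $C:V\cup E\to\{0,\tfrac1H,\tfrac2H,\dots\}\cap[0,1]$, of size $|C|=\sum_e u(e)C(e)+\sum_v u(v)C(v)$; $G-C$ is $G$ with every vertex/edge length $\ell(x)$ increased to $\ell(x)+H\cdot C(x)$. For $h'>0$, $\mathrm{sep}_{h'}(C,D)=\sum_{(u,v):\mathrm{dist}_{G-C}(u,v)>h'}D(u,v)$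 and, when positive, $\mathrm{spars}_{h'}(C,D)=|C|/\mathrm{sep}_{h'}(C,D)$. For an $hs$-length moving cut $C$, $\mathrm{spars}_{(h,s)}(C,A)$ is the minimum of $\mathrm{spars}_{hs}(C,D)$ over all $A$-respecting $h$-length demands $D$ (zero separation counts as $+\infty$). The $(h,s)$-length conductance of $A$ is the minimum of $\mathrm{spars}_{(h,s)}(C,A)$ over all $hs$-length moving cuts $C$, and $A$ is $(h,s)$-length $\phi$-expanding if this conductance is at least $\phi$ (evaluated in the graph in question).
   Formalization: The formal statement assumes φ > 0 and length slack s ≥ 1; as literally written the claim fails for φ < 0 (negative size bound) and for s < 1 (the zero cut can already separate an h-length demand). *)

theory Defs
  imports "HOL-Analysis.Analysis" "HOL-Library.Extended_Real"
begin

text \<open>Vertex-capacitated graphs. Vertices have type 'v; an undirected edge is a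
  two-element set of vertices. Graph elements (vertices and edges) are encoded as
  the sum type 'v + 'v set: Inl v is vertex v, Inr e is edge e. Length and capacity
  functions are functions on elements.\<close>

type_synonym 'v elem = "'v + 'v set"

definition is_graph :: "'v set \<Rightarrow> 'v set set \<Rightarrow> bool" where
  "is_graph V E \<longleftrightarrow> finite V \<and>
     E \<subseteq> {e. \<exists>a b. a \<in> V \<and> b \<in> V \<and> a \<noteq> b \<and> e = {a, b}}"

definition elems :: "'v set \<Rightarrow> 'v set set \<Rightarrow> 'v elem set" where
  "elems V E = Inl ` V \<union> Inr ` E"

definition simple_path :: "'v set \<Rightarrow> 'v set set \<Rightarrow> 'v list \<Rightarrow> 'v \<Rightarrow> 'v \<Rightarrow> bool" where
  "simple_path V E p v w \<longleftrightarrow> p \<noteq> [] \<and> hd p = v \<and> last p = w \<and> distinct p \<and>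
     set p \<subseteq> V \<and> (\<forall>i < length p - 1. {p ! i, p ! Suc i} \<in> E)"

definition path_len :: "('v elem \<Rightarrow> real) \<Rightarrow> 'v list \<Rightarrow> real" where
  "path_len L p = sum_list (map (\<lambda>x. L (Inl x)) p) +
     sum_list (map (\<lambda>i. L (Inr {p ! i, p ! Suc i})) [0..<length p - 1])"

text \<open>Distance (infinite if no path exists).\<close>
definition gdist :: "'v set \<Rightarrow> 'v set set \<Rightarrow> ('v elem \<Rightarrow> real) \<Rightarrow> 'v \<Rightarrow> 'v \<Rightarrow> ereal" where
  "gdist V E L v w = (INF p \<in> {p. simple_path V E p v w}. ereal (path_len L p))"

definition moving_cut :: "'v set \<Rightarrow> 'v set set \<Rightarrow> real \<Rightarrow> ('v elem \<Rightarrow> real) \<Rightarrow> bool" where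
  "moving_cut V E H C \<longleftrightarrow>
     (\<forall>x \<in> elems V E. (\<exists>k::nat. C x = real k / H) \<and> 0 \<le> C x \<and> C x \<le> 1) \<and>
     (\<forall>x. x \<notin> elems V E \<longrightarrow> C x = 0)"

definition cut_size :: "'v set \<Rightarrow> 'v set set \<Rightarrow> ('v elem \<Rightarrow> real) \<Rightarrow> ('v elem \<Rightarrow> real) \<Rightarrow> real" where
  "cut_size V E u C = (\<Sum>e\<in>E. u (Inr e) * C (Inr e)) + (\<Sum>v\<in>V. u (Inl v) * C (Inl v))"

definition cut_graph :: "('v elem \<Rightarrow> real) \<Rightarrow> real \<Rightarrow> ('v elem \<Rightarrow> real) \<Rightarrow> ('v elem \<Rightarrow> real)" where
  "cut_graph L H C = (\<lambda>x. L x + H * C x)"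

definition weight :: "'v set \<Rightarrow> ('v \<Rightarrow> real) \<Rightarrow> real" where
  "weight V A = (\<Sum>v\<in>V. A v)"

definition demand_respecting :: "'v set \<Rightarrow> ('v \<Rightarrow> real) \<Rightarrow> ('v \<Rightarrow> 'v \<Rightarrow> real) \<Rightarrow> bool" where
  "demand_respecting V A D \<longleftrightarrow> (\<forall>v w. 0 \<le> D v w) \<and>
     (\<forall>v w. D v w \<noteq> 0 \<longrightarrow> v \<in> V \<and> w \<in> V) \<and>
     (\<forall>v \<in> V. max (\<Sum>w\<in>V. D v w) (\<Sum>w\<in>V. D w v) \<le> A v)"

definition h_length_demand :: "'v set \<Rightarrow> 'v set set \<Rightarrow> ('v elem \<Rightarrow> real) \<Rightarrow> real \<Rightarrow> ('v \<Rightarrow> 'v \<Rightarrow> real) \<Rightarrow> bool" where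
  "h_length_demand V E L h D \<longleftrightarrow> (\<forall>v w. D v w > 0 \<longrightarrow> gdist V E L v w \<le> ereal h)"

definition sep :: "'v set \<Rightarrow> 'v set set \<Rightarrow> ('v elem \<Rightarrow> real) \<Rightarrow> real \<Rightarrow> ('v elem \<Rightarrow> real)
                    \<Rightarrow> real \<Rightarrow> ('v \<Rightarrow> 'v \<Rightarrow> real) \<Rightarrow> real" where
  "sep V E L H C h' D = (\<Sum>(v, w) \<in> V \<times> V.
       if gdist V E (cut_graph L H C) v w > ereal h' then D v w else 0)"

definition spars_hs :: "'v set \<Rightarrow> 'v set set \<Rightarrow> ('v elem \<Rightarrow> real) \<Rightarrow> ('v elem \<Rightarrow> real)
                        \<Rightarrow> real \<Rightarrow> real \<Rightarrow> ('v elem \<Rightarrow> real) \<Rightarrow> ('v \<Rightarrow> real) \<Rightarrow> ereal" where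
  "spars_hs V E L u h s C A =
     (INF D \<in> {D. demand_respecting V A D \<and> h_length_demand V E L h D}.
        (let S = sep V E L (h * s) C (h * s) D in
         if S = 0 then \<infinity> else ereal (cut_size V E u C / S)))"

definition length_conductance :: "'v set \<Rightarrow> 'v set set \<Rightarrow> ('v elem \<Rightarrow> real) \<Rightarrow> ('v elem \<Rightarrow> real)
                        \<Rightarrow> real \<Rightarrow> real \<Rightarrow> ('v \<Rightarrow> real) \<Rightarrow> ereal" where
  "length_conductance V E L u h s A =
     (INF C \<in> {C. moving_cut V E (h * s) C}. spars_hs V E L u h s C A)"

definition length_expanding :: "'v set \<Rightarrow> 'v set set \<Rightarrow> ('v elem \<Rightarrow> real) \<Rightarrow> ('v elem \<Rightarrow> real)
                        \<Rightarrow> real \<Rightarrow> real \<Rightarrow> real \<Rightarrow> ('v \<Rightarrow> real) \<Rightarrow> bool" where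
  "length_expanding V E L u h s \<phi> A \<longleftrightarrow> length_conductance V E L u h s A \<ge> ereal \<phi>"

end

theory Submission
  imports Defs
begin

text \<open>
  Give every length function \<open>L\<close> a nonnegative potential \<open>\<Phi> L\<close> that drops by at least the total
  demand whenever an \<open>A\<close>-respecting demand of length at most \<open>h\<close> is pushed to distances beyond
  \<open>h s\<close>. A moving cut \<open>C\<close> minimising \<open>|C| + \<phi> \<Phi>(G - C)\<close> then works: a cut of sparsity below \<open>\<phi>\<close> in
  \<open>G - C\<close> could be added to \<open>C\<close> and would decrease this quantity, while comparison with the
  empty cut gives \<open>|C| \<le> \<phi> \<Phi>(G)\<close>.

  For large \<open>s\<close> the potential is a multiple of \<open>\<Sum>\<^sub>v A(v) ln Z(v)\<close> where
  \<open>Z(v) = 1 + \<Sum>\<^sub>x exp (- \<beta> d(v,x))\<close>, \<open>d\<close> is the distance truncated at \<open>h s\<close> and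
  \<open>\<beta>\<close> is of order \<open>ln n / (h s)\<close>. If \<open>d(v,w) \<le> h\<close>, the summands of \<open>Z(v)\<close> and \<open>Z(w)\<close> agree up to a
  factor \<open>n\<close> to the \<open>O(1/s)\<close>; once \<open>v\<close> and \<open>w\<close> are separated, every \<open>x\<close> is at distance at least
  \<open>h s / 2\<close> from \<open>v\<close> or from \<open>w\<close>, so its contribution to \<open>Z(v)\<close> or to \<open>Z(w)\<close> is lost.
  For bounded \<open>s\<close> it suffices that every pair of vertices is separated at most once.
\<close>

section \<open>Paths\<close>

lemma path_len_singleton [simp]: "path_len L [x] = L (Inl x)"
  by (simp add: path_len_def)

lemma path_len_Cons [simp]:
  "path_len L (x # y # p) = L (Inl x) + L (Inr {x, y}) + path_len L (y # p)"
proof -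
  have "[0..<length (x # y # p) - 1] = 0 # map Suc [0..<length (y # p) - 1]"
    by (simp add: map_Suc_upt upt_conv_Cons del: upt_Suc)
  then show ?thesis
    unfolding path_len_def by (simp add: o_def del: upt_Suc)
qed

text \<open>Both pieces contain the vertex \<open>z\<close>, so its length is subtracted
  once.\<close>

lemma path_len_append:
  "path_len L (xs @ z # ys) = path_len L (xs @ [z]) + path_len L (z # ys) - L (Inl z)"
proof (induction xs)
  case (Cons x xs)
  then show ?case by (cases xs) auto
qed simp

lemma path_len_rev: "path_len L (rev p) = path_len L p"
proof (induction p)
  case (Cons x p)
  show ?case
  proof (cases p)
    case (Cons y ys)
    have "path_len L (rev ys @ y # [x]) = path_len L (rev ys @ [y]) + path_len L [y, x] - L (Inl y)"
      by (rule path_len_append)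
    then show ?thesis using Cons Cons.IH by (simp add: insert_commute)
  qed simp
qed simp

text \<open>Trades list indices for \<open>successively\<close>, which has rules for append and
  reversal.\<close>

lemma simple_path_iff:
  "simple_path V E p v w \<longleftrightarrow> p \<noteq> [] \<and> hd p = v \<and> last p = w \<and> distinct p \<and>
     set p \<subseteq> V \<and> successively (\<lambda>a b. {a, b} \<in> E) p"
  unfolding simple_path_def successively_conv_nth
  by (metis Suc_lessD Suc_lessI less_diff_conv Suc_eq_plus1)

lemma simple_path_rev: "simple_path V E p v w \<Longrightarrow> simple_path V E (rev p) w v"
  by (simp add: simple_path_iff hd_rev last_rev insert_commute)

lemma finite_simple_paths: "finite V \<Longrightarrow> finite {p. simple_path V E p v w}"
  by (rule finite_subset[OF _ finite_subset_distinct[of V]]) (auto simp: simple_path_def)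

lemma path_len_mono:
  assumes "simple_path V E p v w" "\<forall>x\<in>elems V E. L x \<le> L' x"
  shows "path_len L p \<le> path_len L' p"
  using assms unfolding path_len_def simple_path_def elems_def
  by (intro add_mono sum_list_mono) auto

lemma path_len_nonneg:
  assumes "simple_path V E p v w" "\<forall>x\<in>elems V E. 0 \<le> L x"
  shows "0 \<le> path_len L p"
  using path_len_mono[OF assms(1), of "\<lambda>_. 0" L] assms(2) by (simp add: path_len_def sum_list_0)

lemma path_len_suffix_le:
  assumes "set (xs @ z # ys) \<subseteq> V" "successively (\<lambda>a b. {a, b} \<in> E) (xs @ z # ys)"
    and "\<forall>x\<in>elems V E. 0 \<le> L x"
  shows "path_len L (z # ys) \<le> path_len L (xs @ z # ys)"
  using assms(1,2)
proof (induction xs)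
  case (Cons x xs)
  obtain y zs where yz: "xs @ z # ys = y # zs" by (cases xs) auto
  have "path_len L (z # ys) \<le> path_len L (xs @ z # ys)"
    using Cons by (auto simp: successively_Cons)
  moreover have "Inl x \<in> elems V E" "Inr {x, y} \<in> elems V E"
    using Cons.prems yz by (auto simp: elems_def)
  then have "0 \<le> L (Inl x)" "0 \<le> L (Inr {x, y})" using assms(3) by blast+
  ultimately show ?case using yz by simp
qed simp

lemma path_len_prefix_le:
  assumes "set (xs @ z # ys) \<subseteq> V" "successively (\<lambda>a b. {a, b} \<in> E) (xs @ z # ys)"
    and "\<forall>x\<in>elems V E. 0 \<le> L x"
  shows "path_len L (xs @ [z]) \<le> path_len L (xs @ z # ys)"
proof -
  have r: "rev (xs @ z # ys) = rev ys @ z # rev xs" "rev (xs @ [z]) = z # rev xs"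
    by simp_all
  have "successively (\<lambda>a b. {a, b} \<in> E) (rev (xs @ z # ys))"
    using assms(2) unfolding successively_rev by (simp add: insert_commute)
  then have "path_len L (z # rev xs) \<le> path_len L (rev ys @ z # rev xs)"
    using assms(1,3) unfolding r by (intro path_len_suffix_le) auto
  then show ?thesis by (metis r path_len_rev)
qed

lemma simple_path_concat:
  assumes p: "simple_path V E p v x" and q: "simple_path V E q x w"
    and L: "\<forall>y\<in>elems V E. 0 \<le> L y"
  shows "\<exists>r. simple_path V E r v w \<and> path_len L r \<le> path_len L p + path_len L q"
proof -
  have "\<exists>z\<in>set p. z \<in> set q"
    using p q unfolding simple_path_iff by (metis hd_in_set last_in_set)
  \<comment> \<open>leave \<open>p\<close> at its first vertex on \<open>q\<close>, so that no further loops have to be removed\<close>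
  then obtain p1 z p2 where p12: "p = p1 @ z # p2" "z \<in> set q" "\<forall>y\<in>set p1. y \<notin> set q"
    using split_list_first_prop[of p "\<lambda>z. z \<in> set q"] by blast
  then obtain q1 q2 where q12: "q = q1 @ z # q2"
    by (meson split_list)
  have lp: "path_len L (p1 @ [z]) \<le> path_len L p" and lq: "path_len L (z # q2) \<le> path_len L q"
    using p q L p12(1) q12 path_len_prefix_le[of p1 z p2 V E L] path_len_suffix_le[of q1 z q2 V E L]
    by (auto simp: simple_path_iff)
  have "z \<in> V" using p p12 by (auto simp: simple_path_iff)
  \<comment> \<open>The vertex \<open>z\<close> is counted in both pieces, and its length is
    nonnegative.\<close>
  then have "path_len L (p1 @ z # q2) \<le> path_len L p + path_len L q"
    using lp lq bspec[OF L, of "Inl z"] path_len_append[of L p1 z q2] by (simp add: elems_def)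
  moreover have "simple_path V E (p1 @ z # q2) v w"
  proof -
    have "successively (\<lambda>a b. {a, b} \<in> E) (p1 @ z # q2)"
      using p q unfolding simple_path_iff p12(1) q12 successively_append_iff by simp
    moreover have "hd (p1 @ z # q2) = hd p" "last (p1 @ z # q2) = last q"
      unfolding p12(1) q12 by (simp_all add: hd_append)
    moreover have "distinct (p1 @ z # q2)" "set (p1 @ z # q2) \<subseteq> V"
      using p q p12 q12 unfolding simple_path_iff by auto
    ultimately show ?thesis using p q unfolding simple_path_iff by simp
  qed
  ultimately show ?thesis by blast
qed

lemma real_member_le_sum_list:
  fixes xs :: "real list"
  shows "x \<in> set xs \<Longrightarrow> \<forall>y\<in>set xs. 0 \<le> y \<Longrightarrow> x \<le> sum_list xs"
  by (induction xs) (auto simp: add_increasing add_increasing2 sum_list_nonneg)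

lemma elem_le_path_len:
  assumes "simple_path V E p v w" "\<forall>x\<in>elems V E. 0 \<le> L x"
    and "x \<in> Inl ` set p \<union> (\<lambda>i. Inr {p ! i, p ! Suc i}) ` {..<length p - 1}"
  shows "L x \<le> path_len L p"
proof -
  let ?a = "map (\<lambda>x. L (Inl x)) p"
  let ?b = "map (\<lambda>i. L (Inr {p ! i, p ! Suc i})) [0..<length p - 1]"
  have nn: "\<forall>y\<in>set ?a. 0 \<le> y" "\<forall>y\<in>set ?b. 0 \<le> y"
    using assms(1,2) unfolding simple_path_def elems_def by auto
  have "L x \<in> set ?a \<or> L x \<in> set ?b" using assms(3) by auto
  then have "L x \<le> sum_list ?a \<or> L x \<le> sum_list ?b"
    using real_member_le_sum_list[OF _ nn(1)] real_member_le_sum_list[OF _ nn(2)] by blast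
  moreover have "0 \<le> sum_list ?a" "0 \<le> sum_list ?b"
    using nn by (auto intro!: sum_list_nonneg)
  ultimately show ?thesis unfolding path_len_def by linarith
qed

lemma path_len_cong:
  assumes "\<And>x. x \<in> Inl ` set p \<union> (\<lambda>i. Inr {p ! i, p ! Suc i}) ` {..<length p - 1} \<Longrightarrow> L x = L' x"
  shows "path_len L p = path_len L' p"
  unfolding path_len_def using assms
  by (intro arg_cong2[where f = "(+)"] arg_cong[where f = sum_list] map_cong) auto

section \<open>Truncated distances\<close>

text \<open>Inserting \<open>H\<close> keeps the minimum over a nonempty finite set and makes it a
  real number even when no path exists, so it can enter an exponential. It is not a metric: for
  \<open>v\<close> in \<open>V\<close> the value from \<open>v\<close> to itself is the vertex
  length, truncated at \<open>H\<close>.\<close>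

definition tdist :: "'v set \<Rightarrow> 'v set set \<Rightarrow> real \<Rightarrow> ('v elem \<Rightarrow> real) \<Rightarrow> 'v \<Rightarrow> 'v \<Rightarrow> real" where
  "tdist V E H L v w = Min (insert H (path_len L ` {p. simple_path V E p v w}))"

lemma tdist_le:
  assumes "finite V"
  shows "tdist V E H L v w \<le> H"
    and "simple_path V E p v w \<Longrightarrow> tdist V E H L v w \<le> path_len L p"
  using finite_simple_paths[OF assms, of E v w] by (auto simp: tdist_def intro!: Min_le)

lemma tdist_cases:
  assumes "finite V"
  obtains "tdist V E H L v w = H"
  | p where "simple_path V E p v w" "tdist V E H L v w = path_len L p"
proof -
  have "tdist V E H L v w \<in> insert H (path_len L ` {p. simple_path V E p v w})"
    unfolding tdist_def using finite_simple_paths[OF assms, of E v w] by (intro Min_in) auto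
  then show ?thesis using that by auto
qed

lemma tdist_nonneg:
  assumes "finite V" "0 \<le> H" "\<forall>x\<in>elems V E. 0 \<le> L x"
  shows "0 \<le> tdist V E H L v w"
  by (rule tdist_cases[OF assms(1), of E H L v w]) (use assms path_len_nonneg in force)+

lemma tdist_sym:
  assumes "finite V"
  shows "tdist V E H L v w = tdist V E H L w v"
proof -
  have "tdist V E H L v w \<le> tdist V E H L w v" for v w
    by (rule tdist_cases[OF assms, of E H L w v])
      (metis tdist_le[OF assms] simple_path_rev path_len_rev)+
  then show ?thesis by (metis order_antisym)
qed

text \<open>If a summand on the right equals \<open>H\<close>, the truncation on the left suffices.
  Otherwise both are attained by paths, which can be concatenated.\<close>

lemma tdist_triangle:
  assumes "finite V" "0 \<le> H" "\<forall>x\<in>elems V E. 0 \<le> L x"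
  shows "tdist V E H L v w \<le> tdist V E H L v x + tdist V E H L x w"
proof -
  note le = tdist_le[OF assms(1)] and nn = tdist_nonneg[OF assms]
  show ?thesis
  proof (cases "tdist V E H L v x = H \<or> tdist V E H L x w = H")
    case True
    then show ?thesis using le(1)[of E H L v w] nn[of v x] nn[of x w] by auto
  next
    case False
    then obtain p q where "simple_path V E p v x" "tdist V E H L v x = path_len L p"
      "simple_path V E q x w" "tdist V E H L x w = path_len L q"
      using tdist_cases[OF assms(1)] by metis
    with simple_path_concat[OF _ _ assms(3)] le(2) show ?thesis
      by (metis order_trans)
  qed
qed

lemma tdist_mono:
  assumes "finite V" "\<forall>x\<in>elems V E. L x \<le> L' x"
  shows "tdist V E H L v w \<le> tdist V E H L' v w"
  by (rule tdist_cases[OF assms(1), of E H L' v w])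
    (use tdist_le[OF assms(1)] path_len_mono[OF _ assms(2)] in \<open>metis order_trans\<close>)+

lemma gdist_mono:
  assumes "\<forall>x\<in>elems V E. L x \<le> L' x"
  shows "gdist V E L v w \<le> gdist V E L' v w"
  unfolding gdist_def using path_len_mono[OF _ assms] by (intro INF_mono) auto

text \<open>An infimum over no paths would be \<infinity>, so a finite bound supplies a path. As
  there are only finitely many simple paths, the infimum is attained.\<close>

lemma tdist_le_of_gdist_le:
  assumes "finite V" "gdist V E L v w \<le> ereal h"
  shows "tdist V E H L v w \<le> h"
proof -
  let ?S = "(\<lambda>p. ereal (path_len L p)) ` {p. simple_path V E p v w}"
  have ne: "?S \<noteq> {}"
  proof
    assume "?S = {}"
    then have "gdist V E L v w = \<infinity>" unfolding gdist_def by (simp only: Inf_empty top_ereal_def)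
    then show False using assms(2) by simp
  qed
  have fin: "finite ?S" using finite_simple_paths[OF assms(1)] by blast
  have "gdist V E L v w = Min ?S"
    unfolding gdist_def using Min_Inf[OF fin ne] by simp
  then obtain p where "simple_path V E p v w" "path_len L p \<le> h"
    using Min_in[OF fin ne] assms(2) by force
  then show ?thesis using tdist_le(2)[OF assms(1)] by (metis order_trans)
qed

lemma tdist_eq_of_gdist_gr:
  assumes "finite V" "ereal H < gdist V E L v w"
  shows "tdist V E H L v w = H"
proof (rule tdist_cases[OF assms(1), of E H L v w])
  fix p assume p: "simple_path V E p v w" "tdist V E H L v w = path_len L p"
  then have "gdist V E L v w \<le> ereal (path_len L p)"
    unfolding gdist_def by (intro INF_lower) auto
  then have "H < path_len L p" using assms(2)
    by (metis less_ereal.simps(1) order_less_le_trans)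
  then show ?thesis using tdist_le(1)[OF assms(1), of E H L v w] p by simp
qed

section \<open>The logarithmic potential\<close>

text \<open>A smoothed count of the vertices within distance about 1/\<beta> of \<open>v\<close>.
  The summand 1 keeps its logarithm nonnegative.\<close>

definition ball_mass :: "'v set \<Rightarrow> real \<Rightarrow> ('v \<Rightarrow> 'v \<Rightarrow> real) \<Rightarrow> 'v \<Rightarrow> real" where
  "ball_mass V \<beta> d v = 1 + (\<Sum>x\<in>V. exp (- \<beta> * d v x))"

lemma ball_mass_ge_1: "1 \<le> ball_mass V \<beta> d v"
  by (simp add: ball_mass_def sum_nonneg)

lemma ball_mass_le:
  assumes "0 \<le> \<beta>" "\<And>x. 0 \<le> d v x"
  shows "ball_mass V \<beta> d v \<le> 1 + real (card V)"
  using sum_bounded_above[of V "\<lambda>x. exp (- \<beta> * d v x)" 1] assms by (simp add: ball_mass_def)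

lemma ball_mass_antimono:
  assumes "0 \<le> \<beta>" "\<And>x. d v x \<le> d' v x"
  shows "ball_mass V \<beta> d' v \<le> ball_mass V \<beta> d v"
  using assms by (auto simp: ball_mass_def intro!: sum_mono mult_left_mono)

text \<open>After separation no vertex is close to both \<open>v\<close> and \<open>w\<close>, so
  \<open>v\<close> loses its mass on \<open>S\<close> and \<open>w\<close> loses its mass on
  \<open>V - S\<close>, up to \<epsilon> each. Before separation the two masses agree up to the
  factor \<open>N\<close>, so the lost fractions add up to at least 1/(2 N^3).\<close>

lemma ln_ball_mass_drop:
  fixes d d' :: "'v \<Rightarrow> 'v \<Rightarrow> real"
  assumes V: "finite V" "v \<in> V" "w \<in> V" and \<beta>: "0 \<le> \<beta>" and h: "0 \<le> h"
    and sym: "\<And>x y. d x y = d y x" "\<And>x y. d' x y = d' y x"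
    and tri: "\<And>x y z. d x z \<le> d x y + d y z" "\<And>x y z. d' x z \<le> d' x y + d' y z"
    and le: "\<And>x y. d x y \<le> d' x y"
    and near: "d v w \<le> h" and far: "H \<le> d' v w"
  shows "1 / (2 * exp (\<beta> * h) ^ 3) - 2 * (real (card V) * exp (- \<beta> * (H / 2)))
    \<le> (ln (ball_mass V \<beta> d v) - ln (ball_mass V \<beta> d' v)) +
       (ln (ball_mass V \<beta> d w) - ln (ball_mass V \<beta> d' w))"
proof -
  define N where "N = exp (\<beta> * h)"
  define \<epsilon> where "\<epsilon> = real (card V) * exp (- \<beta> * (H / 2))"
  define S where "S = {x\<in>V. H / 2 \<le> d' v x}"
  let ?y = "\<lambda>a x. exp (- \<beta> * d a x)"
  define P1 where "P1 = sum (?y v) S"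
  define P2 where "P2 = sum (?y v) (V - S)"
  define Q1 where "Q1 = sum (?y w) S"
  define Q2 where "Q2 = sum (?y w) (V - S)"
  define P where "P = ball_mass V \<beta> d v"
  define Q where "Q = ball_mass V \<beta> d w"
  define P' where "P' = ball_mass V \<beta> d' v"
  define Q' where "Q' = ball_mass V \<beta> d' w"
  have S: "S \<subseteq> V" "finite S" using V by (auto simp: S_def)
  have split: "sum f V = sum f S + sum f (V - S)" for f :: "'v \<Rightarrow> real"
    using sum.subset_diff[OF S(1) V(1), of f] by simp
  have N1: "1 \<le> N" using \<beta> h by (simp add: N_def)
  have \<epsilon>0: "0 \<le> \<epsilon>" by (simp add: \<epsilon>_def)
  have P: "P = 1 + (P1 + P2)" and Q: "Q = 1 + (Q1 + Q2)"
    by (simp_all add: P_def Q_def P1_def P2_def Q1_def Q2_def ball_mass_def split)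
  have pos: "0 \<le> P1" "0 \<le> P2" "0 \<le> Q1" "0 \<le> Q2"
    by (simp_all add: P1_def P2_def Q1_def Q2_def sum_nonneg)
  have y_le: "?y a x \<le> N * ?y b x" if "d a b \<le> h" for a b x
  proof -
    have "d b x \<le> h + d a x" using tri(1)[of b x a] sym(1)[of a b] that by linarith
    then have "\<beta> * d b x \<le> \<beta> * (h + d a x)" using \<beta> by (rule mult_left_mono)
    then show ?thesis unfolding N_def exp_add[symmetric] by (simp add: algebra_simps)
  qed
  have vw: "d v w \<le> h" "d w v \<le> h" using near sym(1) by metis+
  have comparable: "Q1 \<le> N * P1" "P1 + P2 \<le> N * (Q1 + Q2)"
    using y_le[OF vw(2)] y_le[OF vw(1)]
    unfolding Q1_def P1_def P2_def Q2_def split[symmetric] sum_distrib_left by (auto intro: sum_mono)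
  \<comment> \<open>A nearby vertex \<open>b\<close> contributes at least 1/N, so the summand 1 in
    \<open>ball_mass\<close> is at most \<open>N\<close> times the rest. The other endpoint serves
    as \<open>b\<close>, since \<open>d a a\<close> may be positive.\<close>
  have big: "1 \<le> N * (\<Sum>x\<in>V. ?y a x)" if "d a b \<le> h" "b \<in> V" for a b
  proof -
    have "\<beta> * d a b \<le> \<beta> * h" using \<beta> that by (intro mult_left_mono)
    then have "1 \<le> N * ?y a b" unfolding N_def exp_add[symmetric] by simp
    also have "\<dots> \<le> N * (\<Sum>x\<in>V. ?y a x)"
      using N1 V(1) that by (intro mult_left_mono member_le_sum) auto
    finally show ?thesis .
  qed
  have bigP: "1 \<le> N * (P1 + P2)" and bigQ: "1 \<le> N * (Q1 + Q2)"
    using big[OF vw(1) V(3)] big[OF vw(2) V(2)]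
    by (simp_all add: P1_def P2_def Q1_def Q2_def split)
  have y'_le: "exp (- \<beta> * d' a x) \<le> ?y a x" for a x
    using \<beta> le by (simp add: mult_left_mono)
  have far_le: "exp (- \<beta> * d' a x) \<le> exp (- \<beta> * (H / 2))" if "H / 2 \<le> d' a x" for a x
    using mult_left_mono[OF that \<beta>] by simp
  have small: "(\<Sum>x\<in>T. exp (- \<beta> * d' a x)) \<le> \<epsilon>" if "T \<subseteq> V" "\<And>x. x \<in> T \<Longrightarrow> H / 2 \<le> d' a x" for T a
  proof -
    have "(\<Sum>x\<in>T. exp (- \<beta> * d' a x)) \<le> real (card T) * exp (- \<beta> * (H / 2))"
      using sum_bounded_above[of T "\<lambda>x. exp (- \<beta> * d' a x)"] far_le that by simp
    also have "\<dots> \<le> \<epsilon>"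
      unfolding \<epsilon>_def using card_mono[OF V(1) that(1)] by (intro mult_right_mono) auto
    finally show ?thesis .
  qed
  have "(\<Sum>x\<in>S. exp (- \<beta> * d' v x)) \<le> \<epsilon>"
    using S by (intro small) (auto simp: S_def)
  moreover have "(\<Sum>x\<in>V - S. exp (- \<beta> * d' v x)) \<le> P2"
    unfolding P2_def by (intro sum_mono y'_le)
  ultimately have P'_le: "P' \<le> 1 + P2 + \<epsilon>"
    by (simp add: P'_def ball_mass_def split)
  \<comment> \<open>Outside \<open>S\<close> the vertex \<open>x\<close> is closer than H/2 to
    \<open>v\<close>, hence at least H/2 away from \<open>w\<close>.\<close>
  have "H / 2 \<le> d' w x" if "x \<in> V - S" for x
    using that far tri(2)[of v w x] sym(2)[of w x] by (auto simp: S_def)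
  then have "(\<Sum>x\<in>V - S. exp (- \<beta> * d' w x)) \<le> \<epsilon>"
    by (intro small) auto
  moreover have "(\<Sum>x\<in>S. exp (- \<beta> * d' w x)) \<le> Q1"
    unfolding Q1_def by (intro sum_mono y'_le)
  ultimately have Q'_le: "Q' \<le> 1 + Q1 + \<epsilon>"
    by (simp add: Q'_def ball_mass_def split)
  \<comment> \<open>A relative loss becomes a loss of logarithm through ln t \<le> t - 1 at t =
    X'/X.\<close>
  have ln_drop: "(T - \<epsilon>) / X \<le> ln X - ln X'" if "1 \<le> X" "1 \<le> X'" "X' \<le> X - T + \<epsilon>" for X X' T :: real
  proof -
    have "ln (X' / X) \<le> X' / X - 1" using that by (intro ln_le_minus_one) simp
    also have "\<dots> = (X' - X) / X" using that by (simp add: diff_divide_distrib)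
    also have "\<dots> \<le> (\<epsilon> - T) / X" using that by (intro divide_right_mono) auto
    also have "\<dots> = - ((T - \<epsilon>) / X)" by (simp add: diff_divide_distrib)
    finally show ?thesis using that by (simp add: ln_div)
  qed
  have eps_div: "\<epsilon> / X \<le> \<epsilon>" if "1 \<le> X" for X
    using that \<epsilon>0 by (simp add: divide_le_eq mult_left_le_one_le mult_le_cancel_left1)
  have P1': "1 \<le> P" and Q1': "1 \<le> Q" using P Q pos by auto
  \<comment> \<open>\<open>R\<close> gives both lost fractions the common denominator 2 N^3 R; the
    numerators \<open>Q1\<close> and \<open>Q2\<close> then add up to \<open>R\<close>.\<close>
  define R where "R = Q1 + Q2"
  have R0: "0 < R" using bigQ N1 pos unfolding R_def
    by (metis add_nonneg_nonneg less_eq_real_def mult_zero_right not_one_le_zero)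
  have P_le: "P \<le> 2 * N ^ 2 * R"
  proof -
    have "P1 + P2 \<le> N * (P1 + P2)" using N1 pos by (simp add: mult_le_cancel_right1)
    then have "P \<le> 2 * (N * (P1 + P2))" using P bigP by simp
    also have "\<dots> \<le> 2 * (N * (N * R))"
      using comparable(2) N1 unfolding R_def by (intro mult_left_mono) auto
    finally show ?thesis by (simp add: power2_eq_square)
  qed
  have Q_le: "Q \<le> 2 * N ^ 3 * R"
  proof -
    have "R \<le> N * R" using N1 R0 by simp
    then have "Q \<le> 2 * (N * R)" using Q bigQ unfolding R_def by simp
    also have "N * R \<le> N ^ 3 * R"
      using N1 R0 power_increasing[of 1 3 N] by (intro mult_right_mono) auto
    finally show ?thesis by simp
  qed
  have "Q1 / (2 * N ^ 3 * R) \<le> P1 / P"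
  proof -
    have "Q1 / (2 * N ^ 3 * R) \<le> (N * P1) / (2 * N ^ 3 * R)"
      using comparable(1) N1 R0 by (intro divide_right_mono) auto
    also have "\<dots> = P1 / (2 * N ^ 2 * R)"
      using N1 by (simp add: power3_eq_cube power2_eq_square)
    also have "\<dots> \<le> P1 / P"
      using P_le P1' pos(1) N1 R0 by (intro divide_left_mono mult_pos_pos) auto
    finally show ?thesis .
  qed
  moreover have "Q2 / (2 * N ^ 3 * R) \<le> Q2 / Q"
    using Q_le Q1' pos(4) N1 R0 by (intro divide_left_mono mult_pos_pos) auto
  moreover have "Q1 / (2 * N ^ 3 * R) + Q2 / (2 * N ^ 3 * R) = 1 / (2 * N ^ 3)"
    using R0 by (simp add: R_def flip: add_divide_distrib)
  ultimately have "1 / (2 * N ^ 3) \<le> P1 / P + Q2 / Q" by linarith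
  moreover have "(P1 - \<epsilon>) / P \<le> ln P - ln P'"
    using P'_le P P1' by (intro ln_drop) (auto simp: P'_def ball_mass_ge_1)
  moreover have "(Q2 - \<epsilon>) / Q \<le> ln Q - ln Q'"
    using Q'_le Q Q1' by (intro ln_drop) (auto simp: Q'_def ball_mass_ge_1)
  ultimately have "1 / (2 * N ^ 3) - 2 * \<epsilon> \<le> (ln P - ln P') + (ln Q - ln Q')"
    using eps_div[OF P1'] eps_div[OF Q1'] by (simp add: diff_divide_distrib)
  then show ?thesis
    by (simp only: N_def \<epsilon>_def P_def Q_def P'_def Q'_def)
qed

section \<open>Potentials that pay for separated demand\<close>

definition is_separation_potential ::
  "'v set \<Rightarrow> 'v set set \<Rightarrow> ('v \<Rightarrow> real) \<Rightarrow> real \<Rightarrow> real \<Rightarrow> (('v elem \<Rightarrow> real) \<Rightarrow> real) \<Rightarrow> bool" where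
  "is_separation_potential V E A h H \<Phi> \<longleftrightarrow>
     (\<forall>L. 0 \<le> \<Phi> L) \<and>
     (\<forall>L L' D. (\<forall>x\<in>elems V E. 0 \<le> L x \<and> L x \<le> L' x) \<longrightarrow> demand_respecting V A D \<longrightarrow>
        (\<forall>v w. 0 < D v w \<longrightarrow> gdist V E L v w \<le> ereal h \<and> ereal H < gdist V E L' v w) \<longrightarrow>
        \<Phi> L' + (\<Sum>v\<in>V. \<Sum>w\<in>V. D v w) \<le> \<Phi> L)"

text \<open>A pair that becomes separated gives up its term A(v), which pays for D(v,w) \<le> A(v).
  No term returns, because distances only grow. The potential is at most n |A|, which is affordable
  only for bounded \<open>s\<close>.\<close>

lemma pair_count_separation_potential:
  fixes V :: "'v set"
  assumes "finite V" "\<forall>v\<in>V. 0 \<le> A v" "h \<le> H"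
  shows "is_separation_potential V E A h H
    (\<lambda>L. \<Sum>v\<in>V. \<Sum>w\<in>V. if gdist V E L v w \<le> ereal H then A v else 0)"
  unfolding is_separation_potential_def
proof (intro conjI allI impI)
  fix L show "0 \<le> (\<Sum>v\<in>V. \<Sum>w\<in>V. if gdist V E L v w \<le> ereal H then A v else 0)"
    using assms by (auto intro!: sum_nonneg)
next
  fix L L' :: "'v elem \<Rightarrow> real" and D
  assume L: "\<forall>x\<in>elems V E. 0 \<le> L x \<and> L x \<le> L' x" and D: "demand_respecting V A D"
    and sep: "\<forall>v w. 0 < D v w \<longrightarrow> gdist V E L v w \<le> ereal h \<and> ereal H < gdist V E L' v w"
  have "(if gdist V E L' v w \<le> ereal H then A v else 0) + D v w
      \<le> (if gdist V E L v w \<le> ereal H then A v else 0)" if vw: "v \<in> V" "w \<in> V" for v w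
  proof (cases "0 < D v w")
    case True
    have "D v w \<le> (\<Sum>w\<in>V. D v w)"
      using D vw assms(1) by (intro member_le_sum) (auto simp: demand_respecting_def)
    also have "\<dots> \<le> A v" using D vw by (auto simp: demand_respecting_def)
    finally have "D v w \<le> A v" .
    moreover have "gdist V E L v w \<le> ereal H"
      using sep True assms(3) by (meson ereal_less_eq(3) order_trans)
    ultimately show ?thesis using sep True by (auto simp: not_le)
  next
    case False
    then have "D v w = 0" using D by (metis demand_respecting_def less_eq_real_def)
    moreover have "gdist V E L v w \<le> gdist V E L' v w" using L by (intro gdist_mono) auto
    ultimately show ?thesis using assms vw by (auto intro: order_trans)
  qed
  then show "(\<Sum>v\<in>V. \<Sum>w\<in>V. if gdist V E L' v w \<le> ereal H then A v else 0) + (\<Sum>v\<in>V. \<Sum>w\<in>V. D v w)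
      \<le> (\<Sum>v\<in>V. \<Sum>w\<in>V. if gdist V E L v w \<le> ereal H then A v else 0)"
    unfolding sum.distrib[symmetric] by (intro sum_mono)
qed

text \<open>Each demand pair causes a joint logarithmic drop of at least 1/(4 N^3) at its endpoints.
  Weighting these drops by \<open>D\<close> and summing charges each vertex at most twice its
  weight, which explains the factor 8 N^3.\<close>

lemma log_separation_potential:
  fixes V :: "'v set"
  assumes V: "finite V" and A: "\<forall>v\<in>V. 0 \<le> A v" and \<beta>: "0 \<le> \<beta>" and h: "0 \<le> h" "h \<le> H"
    and small: "8 * exp (\<beta> * h) ^ 3 * (real (card V) * exp (- \<beta> * (H / 2))) \<le> 1"
  shows "is_separation_potential V E A h H
    (\<lambda>L. 8 * exp (\<beta> * h) ^ 3 * (\<Sum>v\<in>V. A v * ln (ball_mass V \<beta> (tdist V E H L) v)))"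
  unfolding is_separation_potential_def
proof (intro conjI allI impI)
  fix L show "0 \<le> 8 * exp (\<beta> * h) ^ 3 * (\<Sum>v\<in>V. A v * ln (ball_mass V \<beta> (tdist V E H L) v))"
    using A by (intro mult_nonneg_nonneg sum_nonneg) (auto simp: ball_mass_ge_1)
next
  fix L L' :: "'v elem \<Rightarrow> real" and D
  assume L: "\<forall>x\<in>elems V E. 0 \<le> L x \<and> L x \<le> L' x" and D: "demand_respecting V A D"
    and sep: "\<forall>v w. 0 < D v w \<longrightarrow> gdist V E L v w \<le> ereal h \<and> ereal H < gdist V E L' v w"
  define N where "N = exp (\<beta> * h)"
  have N0: "0 < N" by (simp add: N_def)
  define \<delta> where "\<delta> v = ln (ball_mass V \<beta> (tdist V E H L) v) - ln (ball_mass V \<beta> (tdist V E H L') v)" for v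
  have H: "0 \<le> H" using h by linarith
  have Lnn: "\<forall>x\<in>elems V E. 0 \<le> L x" "\<forall>x\<in>elems V E. 0 \<le> L' x"
    and Lle: "\<forall>x\<in>elems V E. L x \<le> L' x" using L by force+
  have \<delta>0: "0 \<le> \<delta> v" for v
  proof -
    have "ball_mass V \<beta> (tdist V E H L') v \<le> ball_mass V \<beta> (tdist V E H L) v"
      using \<beta> tdist_mono[OF V Lle] by (intro ball_mass_antimono)
    then show ?thesis
      using ball_mass_ge_1[of V \<beta> "tdist V E H L'" v] by (simp add: \<delta>_def ln_mono)
  qed
  have drop: "1 / (4 * N ^ 3) \<le> \<delta> v + \<delta> w" if "v \<in> V" "w \<in> V" "0 < D v w" for v w
  proof -
    have "1 / (2 * N ^ 3) - 2 * (real (card V) * exp (- \<beta> * (H / 2))) \<le> \<delta> v + \<delta> w"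
      unfolding \<delta>_def N_def
    proof (rule ln_ball_mass_drop[OF V that(1,2) \<beta> h(1)])
      show "tdist V E H L v w \<le> h" using sep that tdist_le_of_gdist_le[OF V] by blast
      show "H \<le> tdist V E H L' v w" using sep that tdist_eq_of_gdist_gr[OF V] by fastforce
    qed (fact tdist_sym[OF V] tdist_triangle[OF V H Lnn(1)] tdist_triangle[OF V H Lnn(2)]
        tdist_mono[OF V Lle])+
    \<comment> \<open>The assumption \<open>small\<close> lets the two error terms consume at most
      half of 1/(2 N^3).\<close>
    moreover have "2 * (real (card V) * exp (- \<beta> * (H / 2))) \<le> 1 / (4 * N ^ 3)"
      using small N0 unfolding N_def[symmetric] by (simp add: field_simps)
    moreover have "1 / (2 * N ^ 3) = 2 * (1 / (4 * N ^ 3))" by simp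
    ultimately show ?thesis by linarith
  qed
  have D0: "0 \<le> D v w" for v w using D by (simp add: demand_respecting_def)
  have "(\<Sum>v\<in>V. \<Sum>w\<in>V. D v w) \<le> (\<Sum>v\<in>V. \<Sum>w\<in>V. 4 * N ^ 3 * (D v w * \<delta> v + D v w * \<delta> w))"
  proof (intro sum_mono)
    fix v w assume vw: "v \<in> V" "w \<in> V"
    show "D v w \<le> 4 * N ^ 3 * (D v w * \<delta> v + D v w * \<delta> w)"
    proof (cases "0 < D v w")
      case True
      then have "1 \<le> 4 * N ^ 3 * (\<delta> v + \<delta> w)" using drop[OF vw] N0 by (simp add: field_simps)
      then have "D v w * 1 \<le> D v w * (4 * N ^ 3 * (\<delta> v + \<delta> w))" by (intro mult_left_mono D0)
      then show ?thesis by (simp add: algebra_simps)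
    next
      case False
      then show ?thesis using D0[of v w] by simp
    qed
  qed
  also have "\<dots> = 4 * N ^ 3 * ((\<Sum>v\<in>V. (\<Sum>w\<in>V. D v w) * \<delta> v) + (\<Sum>v\<in>V. \<Sum>w\<in>V. D v w * \<delta> w))"
    by (simp add: sum_distrib_left[symmetric] sum_distrib_right[symmetric] sum.distrib)
  also have "(\<Sum>v\<in>V. \<Sum>w\<in>V. D v w * \<delta> w) = (\<Sum>w\<in>V. (\<Sum>v\<in>V. D v w) * \<delta> w)"
    by (subst sum.swap) (simp add: sum_distrib_right)
  \<comment> \<open>Outgoing and incoming demand at a vertex are each at most its weight, and the
    drops \<delta> are nonnegative.\<close>
  also have "4 * N ^ 3 * ((\<Sum>v\<in>V. (\<Sum>w\<in>V. D v w) * \<delta> v) + (\<Sum>w\<in>V. (\<Sum>v\<in>V. D v w) * \<delta> w))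
      \<le> 4 * N ^ 3 * ((\<Sum>v\<in>V. A v * \<delta> v) + (\<Sum>w\<in>V. A w * \<delta> w))"
    using D N0 \<delta>0 by (intro mult_left_mono add_mono sum_mono mult_right_mono)
      (auto simp: demand_respecting_def)
  also have "\<dots> = 8 * N ^ 3 * (\<Sum>v\<in>V. A v * \<delta> v)" by simp
  also have "\<dots> = 8 * N ^ 3 * (\<Sum>v\<in>V. A v * ln (ball_mass V \<beta> (tdist V E H L) v))
      - 8 * N ^ 3 * (\<Sum>v\<in>V. A v * ln (ball_mass V \<beta> (tdist V E H L') v))"
    by (simp add: \<delta>_def right_diff_distrib sum_subtractf)
  finally show "8 * exp (\<beta> * h) ^ 3 * (\<Sum>v\<in>V. A v * ln (ball_mass V \<beta> (tdist V E H L') v)) +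
      (\<Sum>v\<in>V. \<Sum>w\<in>V. D v w)
      \<le> 8 * exp (\<beta> * h) ^ 3 * (\<Sum>v\<in>V. A v * ln (ball_mass V \<beta> (tdist V E H L) v))"
    by (simp add: N_def)
qed

section \<open>Moving cuts\<close>

lemma finite_elems: "is_graph V E \<Longrightarrow> finite (elems V E)"
proof -
  assume g: "is_graph V E"
  then have "E \<subseteq> Pow V" "finite V" by (auto simp: is_graph_def)
  then show ?thesis unfolding elems_def by (auto intro: finite_subset)
qed

text \<open>Only finitely many multiples of 1/H lie in the unit interval, and cuts vanish off the
  finite set of elements. This is what guarantees a minimising cut.\<close>

lemma finite_moving_cuts:
  assumes "is_graph V E" "0 < H"
  shows "finite {C. moving_cut V E H C}"
proof (rule finite_subset)
  let ?B = "(\<lambda>k. real k / H) ` {..nat \<lfloor>H\<rfloor>}"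
  show "{C. moving_cut V E H C} \<subseteq> {C. \<forall>x. (x \<in> elems V E \<longrightarrow> C x \<in> ?B) \<and> (x \<notin> elems V E \<longrightarrow> C x = 0)}"
  proof clarify
    fix C x assume C: "moving_cut V E H C"
    have "C x \<in> ?B" if x: "x \<in> elems V E"
    proof -
      obtain k :: nat where k: "C x = real k / H" "C x \<le> 1"
        using C x unfolding moving_cut_def by blast
      then have "real k \<le> H" using assms(2) by (simp add: pos_divide_le_eq)
      then have "k \<le> nat \<lfloor>H\<rfloor>" by (simp add: le_nat_floor)
      then show ?thesis using k by blast
    qed
    then show "(x \<in> elems V E \<longrightarrow> C x \<in> ?B) \<and> (x \<notin> elems V E \<longrightarrow> C x = 0)"
      using C by (auto simp: moving_cut_def)
  qed
  show "finite {C. \<forall>x. (x \<in> elems V E \<longrightarrow> C x \<in> ?B) \<and> (x \<notin> elems V E \<longrightarrow> C x = (0::real))}"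
    using finite_elems[OF assms(1)] by (intro finite_set_of_finite_funs) auto
qed

text \<open>The cap is the largest multiple of \<open>1 / H\<close> in the unit interval. As lengths are at least 1,
  capped elements still have length more than \<open>H\<close>.\<close>

definition cap_add :: "real \<Rightarrow> ('v elem \<Rightarrow> real) \<Rightarrow> ('v elem \<Rightarrow> real) \<Rightarrow> 'v elem \<Rightarrow> real" where
  "cap_add H C C' x = min (C x + C' x) (of_int \<lfloor>H\<rfloor> / H)"

lemma moving_cut_cap_add:
  assumes H: "0 < H" and C: "moving_cut V E H C" and C': "moving_cut V E H C'"
  shows "moving_cut V E H (cap_add H C C')"
    and "x \<in> elems V E \<Longrightarrow> C x \<le> cap_add H C C' x"
proof -
  have fl: "of_int \<lfloor>H\<rfloor> / H = real (nat \<lfloor>H\<rfloor>) / H" using H by simp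
  have *: "(\<exists>k::nat. cap_add H C C' x = real k / H) \<and> C x \<le> cap_add H C C' x \<and>
      0 \<le> cap_add H C C' x \<and> cap_add H C C' x \<le> 1" if x: "x \<in> elems V E" for x
  proof -
    obtain k k' :: nat where k: "C x = real k / H" "C' x = real k' / H" "C x \<le> 1"
      "0 \<le> C x" "0 \<le> C' x"
      using C C' x unfolding moving_cut_def by blast
    \<comment> \<open>\<open>H\<close> need not be an integer, but \<open>k\<close> is, so
      \<open>k\<close> is at most the floor of \<open>H\<close>. Hence capping never falls below the
      old cut.\<close>
    have "real k \<le> H" using k(1,3) H by (simp add: pos_divide_le_eq)
    then have kH: "real k \<le> real (nat \<lfloor>H\<rfloor>)" by (simp only: of_nat_le_iff le_nat_floor)
    have "cap_add H C C' x = real (k + k') / H \<or> cap_add H C C' x = real (nat \<lfloor>H\<rfloor>) / H"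
      unfolding cap_add_def fl min_def k by (simp add: add_divide_distrib)
    then have "\<exists>k::nat. cap_add H C C' x = real k / H" by blast
    moreover have "C x \<le> of_int \<lfloor>H\<rfloor> / H"
      unfolding fl k using kH H by (intro divide_right_mono) auto
    moreover have "of_int \<lfloor>H\<rfloor> / H \<le> 1" using H by simp
    ultimately show ?thesis using k unfolding cap_add_def by auto
  qed
  show "x \<in> elems V E \<Longrightarrow> C x \<le> cap_add H C C' x" using * by blast
  have "cap_add H C C' x = 0" if "x \<notin> elems V E" for x
    using that C C' H by (auto simp: cap_add_def moving_cut_def)
  with * show "moving_cut V E H (cap_add H C C')"
    unfolding moving_cut_def by blast
qed

lemma cut_size_cap_add:
  assumes "\<And>x. 0 \<le> u x"
  shows "cut_size V E u (cap_add H C C') \<le> cut_size V E u C + cut_size V E u C'"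
proof -
  have "u x * cap_add H C C' x \<le> u x * C x + u x * C' x" for x
    unfolding distrib_left[symmetric] using assms by (intro mult_left_mono) (auto simp: cap_add_def)
  then have "cut_size V E u (cap_add H C C')
      \<le> (\<Sum>e\<in>E. u (Inr e) * C (Inr e) + u (Inr e) * C' (Inr e)) +
         (\<Sum>v\<in>V. u (Inl v) * C (Inl v) + u (Inl v) * C' (Inl v))"
    unfolding cut_size_def by (intro add_mono sum_mono)
  then show ?thesis by (simp add: cut_size_def sum.distrib)
qed

text \<open>A path through elements unaffected by the cap has the same length in both graphs. Any
  other path contains a capped element, which alone is longer than \<open>H\<close>.\<close>

lemma gdist_cap_add:
  assumes H: "0 < H" and L: "\<forall>x\<in>elems V E. 1 \<le> L x"
    and C: "moving_cut V E H C" "moving_cut V E H C'"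
    and far: "ereal H < gdist V E (cut_graph (cut_graph L H C) H C') v w"
  shows "ereal H < gdist V E (cut_graph L H (cap_add H C C')) v w"
proof -
  let ?full = "cut_graph (cut_graph L H C) H C'" and ?cap = "cut_graph L H (cap_add H C C')"
  have cap_nonneg: "0 \<le> cap_add H C C' x" if "x \<in> elems V E" for x
    using moving_cut_cap_add(1)[OF H C] that by (simp add: moving_cut_def)
  have nn: "\<forall>x\<in>elems V E. 0 \<le> ?cap x"
  proof
    fix x assume x: "x \<in> elems V E"
    have "0 \<le> L x" using L x by force
    then show "0 \<le> ?cap x" using cap_nonneg[OF x] H by (simp add: cut_graph_def)
  qed
  \<comment> \<open>An infimum need not preserve strict inequalities, so a fixed lower bound is
    shown for all paths. It exceeds \<open>H\<close> strictly because 1 plus the floor of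
    \<open>H\<close> does.\<close>
  have "min (gdist V E ?full v w) (ereal (1 + of_int \<lfloor>H\<rfloor>)) \<le> gdist V E ?cap v w"
    unfolding gdist_def[of V E ?cap]
  proof (intro INF_greatest)
    fix p assume "p \<in> {p. simple_path V E p v w}"
    then have p: "simple_path V E p v w" by simp
    let ?X = "Inl ` set p \<union> (\<lambda>i. Inr {p ! i, p ! Suc i}) ` {..<length p - 1}"
    show "min (gdist V E ?full v w) (ereal (1 + of_int \<lfloor>H\<rfloor>)) \<le> ereal (path_len ?cap p)"
    proof (cases "\<forall>x\<in>?X. ?cap x = ?full x")
      case True
      then have "path_len ?cap p = path_len ?full p" by (intro path_len_cong) auto
      moreover have "gdist V E ?full v w \<le> ereal (path_len ?full p)"
        unfolding gdist_def using p by (intro INF_lower) auto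
      ultimately show ?thesis by (simp add: min.coboundedI1)
    next
      case False
      then obtain x where x: "x \<in> ?X" "?cap x \<noteq> ?full x" by blast
      have xe: "x \<in> elems V E"
        using x(1) p unfolding simple_path_def elems_def by auto
      have "cap_add H C C' x = of_int \<lfloor>H\<rfloor> / H"
        using x(2) by (auto simp: cut_graph_def cap_add_def min_def distrib_left split: if_splits)
      then have "1 + of_int \<lfloor>H\<rfloor> \<le> ?cap x"
        using L xe H by (simp add: cut_graph_def)
      also have "\<dots> \<le> path_len ?cap p"
        using p nn x(1) by (rule elem_le_path_len)
      finally show ?thesis by (simp add: min.coboundedI2)
    qed
  qed
  moreover have "ereal H < min (gdist V E ?full v w) (ereal (1 + of_int \<lfloor>H\<rfloor>))"
    using far by (simp; linarith)
  ultimately show ?thesis by (rule order_less_le_trans[rotated])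
qed

section \<open>From a potential to an expander decomposition\<close>

lemma length_expandingI:
  assumes "\<And>C D. moving_cut V E (h * s) C \<Longrightarrow> demand_respecting V A D \<Longrightarrow> h_length_demand V E L h D \<Longrightarrow>
      \<phi> * sep V E L (h * s) C (h * s) D \<le> cut_size V E u C"
  shows "length_expanding V E L u h s \<phi> A"
  unfolding length_expanding_def length_conductance_def spars_hs_def Let_def
proof (intro INF_greatest, clarsimp)
  fix C D assume CD: "moving_cut V E (h * s) C" "demand_respecting V A D" "h_length_demand V E L h D"
    and S: "sep V E L (h * s) C (h * s) D \<noteq> 0"
  have "0 \<le> sep V E L (h * s) C (h * s) D"
    using CD(2) unfolding sep_def demand_respecting_def by (auto intro!: sum_nonneg)
  then show "\<phi> \<le> cut_size V E u C / sep V E L (h * s) C (h * s) D"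
    using S assms[OF CD] by (simp add: pos_le_divide_eq)
qed

text \<open>A single minimisation replaces repeated cutting. Adding \<open>C'\<close> to the
  minimiser costs at most |C'| and lowers the potential term by at least \<phi> times the separated
  demand, so minimality gives the required inequality directly.\<close>

lemma expander_decomposition_of_potential:
  fixes V :: "'v set"
  assumes g: "is_graph V E" and L: "\<forall>x\<in>elems V E. 1 \<le> L x" and u: "\<And>x. 0 \<le> u x"
    and H: "0 < h * s" and \<phi>: "0 < \<phi>"
    and \<Phi>: "is_separation_potential V E A h (h * s) \<Phi>"
  shows "\<exists>C. moving_cut V E (h * s) C \<and> cut_size V E u C \<le> \<phi> * \<Phi> L \<and>
    length_expanding V E (cut_graph L (h * s) C) u h s \<phi> A"
proof -
  define H where "H = h * s"
  have H0: "0 < H" using H by (simp add: H_def)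
  let ?M = "{C. moving_cut V E H C}"
  define obj where "obj C = cut_size V E u C + \<phi> * \<Phi> (cut_graph L H C)" for C
  have z: "(\<lambda>_. 0) \<in> ?M"
    by (auto simp: moving_cut_def intro: exI[of _ 0])
  then have ne: "?M \<noteq> {}" by blast
  have fin: "finite ?M" by (rule finite_moving_cuts[OF g H0])
  obtain C where C: "moving_cut V E H C" and min: "\<And>C'. moving_cut V E H C' \<Longrightarrow> obj C \<le> obj C'"
    using arg_min_if_finite[OF fin ne, of obj] by (auto simp: not_less)
  have "obj C \<le> \<phi> * \<Phi> L"
    using min[of "\<lambda>_. 0"] z by (simp add: obj_def cut_size_def cut_graph_def)
  moreover have "0 \<le> \<phi> * \<Phi> (cut_graph L H C)"
    using \<Phi> \<phi> by (simp add: is_separation_potential_def)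
  ultimately have size: "cut_size V E u C \<le> \<phi> * \<Phi> L" by (simp add: obj_def)
  have "length_expanding V E (cut_graph L H C) u h s \<phi> A"
  proof (rule length_expandingI)
    fix C' D assume C': "moving_cut V E (h * s) C'" and D: "demand_respecting V A D"
      and hD: "h_length_demand V E (cut_graph L H C) h D"
    note C' = C'[folded H_def]
    let ?full = "cut_graph (cut_graph L H C) H C'" and ?cap = "cut_graph L H (cap_add H C C')"
    \<comment> \<open>The potential pays only for demands all of whose pairs get separated.
      Restricting \<open>D\<close> to such pairs keeps it respecting, and the total of
      \<open>D'\<close> is exactly the separation of \<open>D\<close>.\<close>
    define D' where "D' v w = (if ereal H < gdist V E ?full v w then D v w else 0)" for v w
    have D'_le: "0 \<le> D' v w" "D' v w \<le> D v w" for v w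
      using D by (auto simp: D'_def demand_respecting_def)
    have D': "demand_respecting V A D'"
      unfolding demand_respecting_def
    proof (intro conjI ballI allI impI)
      fix v w assume "D' v w \<noteq> 0"
      then have "D v w \<noteq> 0" by (auto simp: D'_def split: if_splits)
      then show "v \<in> V" "w \<in> V" using D unfolding demand_respecting_def by blast+
    next
      fix v assume "v \<in> V"
      then have "(\<Sum>w\<in>V. D v w) \<le> A v" "(\<Sum>w\<in>V. D w v) \<le> A v"
        using D by (auto simp: demand_respecting_def)
      moreover have "(\<Sum>w\<in>V. D' v w) \<le> (\<Sum>w\<in>V. D v w)" "(\<Sum>w\<in>V. D' w v) \<le> (\<Sum>w\<in>V. D w v)"
        by (intro sum_mono D'_le)+
      ultimately show "max (\<Sum>w\<in>V. D' v w) (\<Sum>w\<in>V. D' w v) \<le> A v" by simp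
    qed (rule D'_le)
    have "gdist V E (cut_graph L H C) v w \<le> ereal h \<and> ereal H < gdist V E ?cap v w"
      if "0 < D' v w" for v w
      using that hD gdist_cap_add[OF H0 L C C'] by (auto simp: D'_def h_length_demand_def split: if_splits)
    moreover have "\<forall>x\<in>elems V E. 0 \<le> cut_graph L H C x \<and> cut_graph L H C x \<le> ?cap x"
    proof
      fix x assume x: "x \<in> elems V E"
      have "0 \<le> L x" "0 \<le> C x" using L C x by (force simp: moving_cut_def)+
      then show "0 \<le> cut_graph L H C x \<and> cut_graph L H C x \<le> ?cap x"
        using moving_cut_cap_add(2)[OF H0 C C' x] H0 by (simp add: cut_graph_def)
    qed
    ultimately have "\<Phi> ?cap + (\<Sum>v\<in>V. \<Sum>w\<in>V. D' v w) \<le> \<Phi> (cut_graph L H C)"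
      using \<Phi> D' unfolding is_separation_potential_def H_def[symmetric] by blast
    moreover have "(\<Sum>v\<in>V. \<Sum>w\<in>V. D' v w) = sep V E (cut_graph L H C) (h * s) C' (h * s) D"
      by (simp add: sep_def D'_def H_def sum.cartesian_product)
    ultimately have "\<phi> * (\<Phi> ?cap + sep V E (cut_graph L H C) (h * s) C' (h * s) D)
        \<le> \<phi> * \<Phi> (cut_graph L H C)"
      using \<phi> by simp
    moreover have "obj C \<le> obj (cap_add H C C')"
      by (intro min moving_cut_cap_add H0 C C')
    ultimately show "\<phi> * sep V E (cut_graph L H C) (h * s) C' (h * s) D \<le> cut_size V E u C'"
      using cut_size_cap_add[of u V E H C C', OF u] by (simp add: obj_def distrib_left)
  qed
  then show ?thesis using C size unfolding H_def by blast
qed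

text \<open>The case split at s = 12 selects the potential. At or above 12 the exponent 48/s is at
  most 4, which keeps the error of the logarithmic potential small; below 12 it exceeds 4, so the
  crude factor \<open>n\<close> is absorbed.\<close>

lemma expander_decomposition_exists:
  fixes V :: "'v set"
  assumes g: "is_graph V E" and L: "\<forall>x\<in>elems V E. 1 \<le> L x" and u: "\<And>x. 0 \<le> u x"
    and A: "\<forall>v\<in>V. 0 \<le> A v" and h: "0 < h" and s: "1 \<le> s" and \<phi>: "0 < \<phi>" and n: "2 \<le> card V"
  shows "\<exists>C. moving_cut V E (h * s) C \<and>
    cut_size V E u C \<le> 16 * real (card V) powr (48 / s) * ln (real (card V)) * \<phi> * weight V A \<and>
    length_expanding V E (cut_graph L (h * s) C) u h s \<phi> A"
proof -
  define n where "n = real (card V)"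
  have n2: "2 \<le> n" using n by (simp add: n_def)
  have ln_n: "1 / 2 \<le> ln n"
    using ln2_ge_two_thirds ln_mono[of 2 n] n2 by linarith
  have fin: "finite V" using g by (simp add: is_graph_def)
  have H: "0 < h * s" "h \<le> h * s" using h s by (auto simp: mult_le_cancel_left1)
  have wt: "0 \<le> weight V A" using A by (auto simp: weight_def intro: sum_nonneg)
  obtain \<Phi> where \<Phi>: "is_separation_potential V E A h (h * s) \<Phi>"
    and bound: "\<Phi> L \<le> 16 * n powr (48 / s) * ln n * weight V A"
  proof (cases "s < 12")
    case True
    let ?\<Phi> = "\<lambda>L. \<Sum>v\<in>V. \<Sum>w\<in>V. if gdist V E L v w \<le> ereal (h * s) then A v else 0"
    have "?\<Phi> L \<le> (\<Sum>v\<in>V. \<Sum>w\<in>V. A v)"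
      using A by (intro sum_mono) auto
    also have "\<dots> = n * weight V A" by (simp add: n_def weight_def sum_distrib_left)
    also have "\<dots> \<le> 16 * n powr (48 / s) * ln n * weight V A"
    proof (rule mult_right_mono[OF _ wt])
      have "n = n powr 1" using n2 by simp
      also have "\<dots> \<le> n powr (48 / s)" using n2 s True by (intro powr_mono) (auto simp: field_simps)
      finally have 1: "n \<le> n powr (48 / s)" .
      have "n powr (48 / s) * 1 \<le> n powr (48 / s) * (16 * ln n)"
        using ln_n by (intro mult_left_mono) auto
      with 1 show "n \<le> 16 * n powr (48 / s) * ln n" by (simp add: mult_ac)
    qed
    finally show ?thesis
      using that pair_count_separation_potential[OF fin A H(2)] by blast
  next
    case False
    \<comment> \<open>This choice makes exp(\<beta> h) equal to n^(16/s), whose cube is n^(48/s),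
      while a vertex at distance h s/2 contributes only n^(-8).\<close>
    define \<beta> where "\<beta> = 16 * ln n / (h * s)"
    have \<beta>: "0 \<le> \<beta>" using ln_n H(1) by (simp add: \<beta>_def)
    have "exp (\<beta> * h) = n powr (16 / s)"
      using n2 h s by (simp add: \<beta>_def powr_def field_simps)
    then have N3: "exp (\<beta> * h) ^ 3 = n powr (48 / s)"
      using n2 by (simp add: powr_realpow[symmetric] powr_powr)
    have "exp (- \<beta> * (h * s / 2)) = n powr (- 8)"
      using n2 h s by (simp add: \<beta>_def powr_def field_simps)
    moreover have "n powr (48 / s) * (n * n powr (- 8)) \<le> n powr (-3)"
    proof -
      have "n powr (48 / s) * (n * n powr (- 8)) = n powr (48 / s + 1 + - 8)"
        using n2 by (simp only: powr_add) simp
      \<comment> \<open>Here 48/s \<le> 4, so the exponent is at most 4 + 1 - 8.\<close>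
      also have "\<dots> \<le> n powr (-3)"
        using n2 False by (intro powr_mono) (auto simp: field_simps)
      finally show ?thesis .
    qed
    moreover have "8 * n powr (-3) \<le> 1"
    proof -
      have "2 ^ 3 \<le> n ^ 3" using n2 by (intro power_mono) auto
      moreover have "n powr (-3) = 1 / n ^ 3"
        using n2 powr_realpow[of n 3] by (simp add: powr_minus_divide)
      ultimately show ?thesis using n2 by simp
    qed
    ultimately have small: "8 * exp (\<beta> * h) ^ 3 * (real (card V) * exp (- \<beta> * (h * s / 2))) \<le> 1"
      unfolding N3 n_def[symmetric] by (simp add: mult.assoc)
    let ?\<Phi> = "\<lambda>L. 8 * exp (\<beta> * h) ^ 3 * (\<Sum>v\<in>V. A v * ln (ball_mass V \<beta> (tdist V E (h * s) L) v))"
    \<comment> \<open>The mass is at most 1 + n \<le> n^2. The resulting 2 ln n times the factor 8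
      gives the constant 16.\<close>
    have "ln (ball_mass V \<beta> (tdist V E (h * s) L) v) \<le> 2 * ln n" for v
    proof -
      have "0 \<le> tdist V E (h * s) L v x" for x
        using L H by (intro tdist_nonneg[OF fin]) force+
      then have "ball_mass V \<beta> (tdist V E (h * s) L) v \<le> 1 + n"
        unfolding n_def by (intro ball_mass_le \<beta>)
      also have "\<dots> \<le> n ^ 2"
      proof -
        have "2 * n \<le> n * n" using n2 by (intro mult_right_mono) auto
        then show ?thesis using n2 unfolding power2_eq_square by linarith
      qed
      finally have "ln (ball_mass V \<beta> (tdist V E (h * s) L) v) \<le> ln (n ^ 2)"
        using ball_mass_ge_1[of V \<beta> "tdist V E (h * s) L" v] by (intro ln_mono) auto
      then show ?thesis using n2 by (simp add: ln_realpow)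
    qed
    then have "(\<Sum>v\<in>V. A v * ln (ball_mass V \<beta> (tdist V E (h * s) L) v)) \<le> (\<Sum>v\<in>V. A v * (2 * ln n))"
      using A by (intro sum_mono mult_left_mono) auto
    also have "\<dots> = weight V A * (2 * ln n)" by (simp add: weight_def sum_distrib_right)
    finally have "?\<Phi> L \<le> 8 * exp (\<beta> * h) ^ 3 * (weight V A * (2 * ln n))"
      by (intro mult_left_mono) auto
    also have "\<dots> = 16 * n powr (48 / s) * ln n * weight V A" by (simp add: N3)
    finally show ?thesis
      using that log_separation_potential[OF fin A \<beta> _ H(2) small] h by (meson less_imp_le)
  qed
  have "\<phi> * \<Phi> L \<le> 16 * n powr (48 / s) * ln n * \<phi> * weight V A"
    using mult_left_mono[OF bound, of \<phi>] \<phi> by (simp only: mult_ac less_imp_le)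
  with expander_decomposition_of_potential[where u = u and L = L, OF g L u H(1) \<phi> \<Phi>] show ?thesis
    unfolding n_def by (elim exE conjE) (intro exI conjI, assumption, rule order_trans, assumption+)
qed

theorem theorem4p1:
  shows "\<forall>cN c0 :: real. \<exists>K c :: real. \<forall>(V :: 'v set) E (len :: 'v elem \<Rightarrow> nat) (u :: 'v elem \<Rightarrow> nat)
            (A :: 'v \<Rightarrow> real) (h :: real) (\<phi> :: real) (s :: real).
     is_graph V E \<and>
     (\<forall>x \<in> elems V E. 0 < len x \<and> real (len x) \<le> real (card V) powr cN \<and>
                       0 < u x \<and> real (u x) \<le> real (card V) powr cN) \<and>
     (\<forall>v \<in> V. 0 \<le> A v) \<and>
     1 < h \<and> 0 < \<phi> \<and> \<phi> < 1 \<and> 1 \<le> s \<and> s \<le> c0 * ln (real (card V))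
     \<longrightarrow> (\<exists>C. moving_cut V E (h * s) C \<and>
            cut_size V E (\<lambda>x. real (u x)) C
              \<le> K * real (card V) powr (c / s) * ln (real (card V)) * \<phi> * weight V A \<and>
            length_expanding V E (cut_graph (\<lambda>x. real (len x)) (h * s) C) (\<lambda>x. real (u x)) h s \<phi> A)"
proof (rule allI, rule allI, rule exI[of _ 16], rule exI[of _ 48], intro allI impI, elim conjE)
  fix cN c0 :: real and V :: "'v set" and E and len u :: "'v elem \<Rightarrow> nat"
    and A :: "'v \<Rightarrow> real" and h \<phi> s :: real
  assume *: "is_graph V E" "\<forall>v\<in>V. 0 \<le> A v" "1 < h" "0 < \<phi>" "1 \<le> s" "s \<le> c0 * ln (real (card V))"
    and len: "\<forall>x \<in> elems V E. 0 < len x \<and> real (len x) \<le> real (card V) powr cN \<and>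
                       0 < u x \<and> real (u x) \<le> real (card V) powr cN"
  \<comment> \<open>For 0 or 1 vertices the logarithm is 0 (by the convention
    \<open>ln 0 = 0\<close> in the first case), so 1 \<le> s \<le> 0 would follow.\<close>
  have "card V \<noteq> 0" "card V \<noteq> 1" using *(5,6) by (intro notI; simp)+
  then have "2 \<le> card V" by linarith
  moreover have "\<forall>x\<in>elems V E. 1 \<le> real (len x)" using len by force
  ultimately show "\<exists>C. moving_cut V E (h * s) C \<and>
      cut_size V E (\<lambda>x. real (u x)) C
        \<le> 16 * real (card V) powr (48 / s) * ln (real (card V)) * \<phi> * weight V A \<and>
      length_expanding V E (cut_graph (\<lambda>x. real (len x)) (h * s) C) (\<lambda>x. real (u x)) h s \<phi> A"
    using * by (intro expander_decomposition_exists) auto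
qed

end
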